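(* Fix integers $s$ and $\ell$ with $s > \ell \ge 2$ and a real number $\epsilon$ with $0 \le \epsilon < \ell$. Suppose that there is an algorithm running in time $T(n,\ell)$ which, given two strings of length at most $n$ over an alphabet of size $\ell$, outputs a common subsequence of them whose length is at least $\frac{1}{\ell-\epsilon}$ times the length of their longest common subsequence. Then there is an algorithm running in time $O\!\left((n+T(n,\ell))\binom{s}{\ell}\right)$ which, given two strings of length at most $n$ over an alphabet of size $s$, outputs a common subsequence of them whose length is at least $\frac{1}{s(1-\epsilon/\ell)}$ times the length of their longest common subsequence.
   Context: A subsequence of a string is obtained by deleting some (possibly none) of its characters while keeping the order of the rest. A common subsequence of strings $A$ and $B$ is a string that is a subsequence of both; $\mathrm{lcs}(A,B)$ denotes the maximum length of a common subsequence of $A$ and $B$. An algorithm achieves a $c$-approximation (for $0<c\le 1$) of the LCS if it always outputs a common subsequence of the two input strings of length at least $c\cdot\mathrm{lcs}(A,B)$. The strings given to an algorithm may have different lengths. *)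

theory Defs
  imports Complex_Main "HOL-Library.Sublist"
begin

text \<open>
  Strings are lists of naturals; an alphabet of size \<open>k\<close> is \<open>{..<k}\<close>.
\<close>

definition string_over :: "nat \<Rightarrow> nat list \<Rightarrow> bool" where
  "string_over k A \<longleftrightarrow> set A \<subseteq> {..<k}"

definition common_subseq :: "nat list \<Rightarrow> nat list \<Rightarrow> nat list \<Rightarrow> bool" where
  "common_subseq C A B \<longleftrightarrow> subseq C A \<and> subseq C B"

definition lcs :: "nat list \<Rightarrow> nat list \<Rightarrow> nat" where
  "lcs A B = Max (length ` {C. common_subseq C A B})"

text \<open>
  The machine model is a unit-cost random access machine over the naturals with instructions
  in the style of Cook and Reckhow (constants, copying, addition, truncated subtraction, indirect reads
  and writes, conditional branching), in structured form: a program mentions finitely many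
  scalar registers \<open>reg x\<close> and finitely many unbounded arrays \<open>mem a\<close>, and jumps are replaced
  by conditionals and loops. Multiplication is deliberately absent, as it is unreasonably
  powerful at unit cost on unbounded numbers.
\<close>

record state =
  reg :: "nat \<Rightarrow> nat"
  mem :: "nat \<Rightarrow> nat \<Rightarrow> nat"

datatype prog =
    Skip
  | Const nat nat          \<comment> \<open>\<open>x := c\<close>\<close>
  | Copy nat nat           \<comment> \<open>\<open>x := y\<close>\<close>
  | Add nat nat nat        \<comment> \<open>\<open>x := y + z\<close>\<close>
  | Sub nat nat nat        \<comment> \<open>\<open>x := y - z\<close>, truncated at \<open>0\<close>\<close>
  | Load nat nat nat       \<comment> \<open>\<open>x := a[y]\<close>\<close>
  | Store nat nat nat      \<comment> \<open>\<open>a[x] := y\<close>\<close>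
  | Seq prog prog
  | If_Less nat nat prog prog  \<comment> \<open>\<open>if x < y then p else q\<close>\<close>
  | While_Less nat nat prog    \<comment> \<open>\<open>while x < y do p\<close>\<close>

definition set_reg :: "nat \<Rightarrow> nat \<Rightarrow> state \<Rightarrow> state" where
  "set_reg x v \<sigma> = \<sigma>\<lparr>reg := (reg \<sigma>)(x := v)\<rparr>"

definition set_mem :: "nat \<Rightarrow> nat \<Rightarrow> nat \<Rightarrow> state \<Rightarrow> state" where
  "set_mem a i v \<sigma> = \<sigma>\<lparr>mem := (mem \<sigma>)(a := (mem \<sigma> a)(i := v))\<rparr>"

text \<open>
  \<open>exec p \<sigma> t \<tau>\<close>: started in \<open>\<sigma>\<close>, the program \<open>p\<close> halts in \<open>\<tau>\<close> after exactly \<open>t\<close> steps, where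
  every instruction and every evaluation of a guard is one step.
\<close>

inductive exec :: "prog \<Rightarrow> state \<Rightarrow> nat \<Rightarrow> state \<Rightarrow> bool" where
  Skip: "exec Skip \<sigma> 1 \<sigma>"
| Const: "exec (Const x c) \<sigma> 1 (set_reg x c \<sigma>)"
| Copy: "exec (Copy x y) \<sigma> 1 (set_reg x (reg \<sigma> y) \<sigma>)"
| Add: "exec (Add x y z) \<sigma> 1 (set_reg x (reg \<sigma> y + reg \<sigma> z) \<sigma>)"
| Sub: "exec (Sub x y z) \<sigma> 1 (set_reg x (reg \<sigma> y - reg \<sigma> z) \<sigma>)"
| Load: "exec (Load x a y) \<sigma> 1 (set_reg x (mem \<sigma> a (reg \<sigma> y)) \<sigma>)"
| Store: "exec (Store a x y) \<sigma> 1 (set_mem a (reg \<sigma> x) (reg \<sigma> y) \<sigma>)"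
| Seq: "exec p \<sigma> t \<sigma>' \<Longrightarrow> exec q \<sigma>' u \<sigma>'' \<Longrightarrow> exec (Seq p q) \<sigma> (t + u) \<sigma>''"
| If_True: "reg \<sigma> x < reg \<sigma> y \<Longrightarrow> exec p \<sigma> t \<sigma>' \<Longrightarrow> exec (If_Less x y p q) \<sigma> (Suc t) \<sigma>'"
| If_False: "\<not> reg \<sigma> x < reg \<sigma> y \<Longrightarrow> exec q \<sigma> t \<sigma>' \<Longrightarrow> exec (If_Less x y p q) \<sigma> (Suc t) \<sigma>'"
| While_False: "\<not> reg \<sigma> x < reg \<sigma> y \<Longrightarrow> exec (While_Less x y p) \<sigma> 1 \<sigma>"
| While_True: "reg \<sigma> x < reg \<sigma> y \<Longrightarrow> exec p \<sigma> t \<sigma>' \<Longrightarrow> exec (While_Less x y p) \<sigma>' u \<sigma>'' \<Longrightarrow>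
    exec (While_Less x y p) \<sigma> (Suc (t + u)) \<sigma>''"

lemma exec_deterministic:
  "exec p \<sigma> t \<tau> \<Longrightarrow> exec p \<sigma> t' \<tau>' \<Longrightarrow> t' = t \<and> \<tau>' = \<tau>"
proof (induction arbitrary: t' \<tau>' rule: exec.induct)
  case (Seq p \<sigma> t \<sigma>' q u \<sigma>'')
  from Seq.prems show ?case by cases (use Seq.IH in blast)
next
  case (While_True \<sigma> x y p t \<sigma>' u \<sigma>'')
  from While_True.prems show ?case by cases (use While_True in blast)+
qed (erule exec.cases; auto)+

text \<open>
  The input strings are in arrays \<open>0\<close> and \<open>1\<close> and their lengths in registers \<open>0\<close> and \<open>1\<close>; all
  other cells are \<open>0\<close>. The output is in array \<open>2\<close> and its length in register \<open>2\<close>.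
\<close>

definition array_of :: "nat list \<Rightarrow> nat \<Rightarrow> nat" where
  "array_of A i = (if i < length A then A ! i else 0)"

definition input_state :: "nat list \<Rightarrow> nat list \<Rightarrow> state" where
  "input_state A B = \<lparr>reg = (\<lambda>_. 0)(0 := length A, 1 := length B),
                      mem = (\<lambda>_ _. 0)(0 := array_of A, 1 := array_of B)\<rparr>"

definition output_string :: "state \<Rightarrow> nat list" where
  "output_string \<sigma> = map (mem \<sigma> 2) [0..<reg \<sigma> 2]"

definition approximates_lcs :: "prog \<Rightarrow> nat \<Rightarrow> real \<Rightarrow> bool" where
  "approximates_lcs P k c \<longleftrightarrow>
     (\<forall>A B. string_over k A \<and> string_over k B \<longrightarrow>
        (\<exists>t \<sigma>. exec P (input_state A B) t \<sigma> \<and> common_subseq (output_string \<sigma>) A B \<and>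
               real (length (output_string \<sigma>)) \<ge> c * real (lcs A B)))"

definition runs_in_time :: "prog \<Rightarrow> nat \<Rightarrow> (nat \<Rightarrow> real) \<Rightarrow> bool" where
  "runs_in_time P k f \<longleftrightarrow>
     (\<forall>n A B. string_over k A \<and> string_over k B \<and> length A \<le> n \<and> length B \<le> n \<longrightarrow>
        (\<exists>t \<sigma>. exec P (input_state A B) t \<sigma> \<and> real t \<le> f n))"

end

theory Submission imports Defs begin

text \<open>
  Instead of all \<open>\<ell>\<close>-subsets of the alphabet it suffices to use the \<open>s\<close> cyclic windows
  \<open>{i, \<dots>, i + \<ell> - 1}\<close> modulo \<open>s\<close>: every letter lies in exactly \<open>\<ell>\<close> of them, so some window keeps
  at least the fraction \<open>\<ell> / s\<close> of a longest common subsequence, and \<open>s \<le> s choose \<ell>\<close>. A window is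
  identified with \<open>{..<\<ell>}\<close> by a rotation, which costs constantly many additions and subtractions
  per letter, uniformly in \<open>s\<close> and \<open>\<ell>\<close>. The given program must start from zeroed memory in each of the
  \<open>s\<close> runs; clearing its registers could cost more than the run itself, so the new program contains
  \<open>s\<close> copies of it that work on disjoint, still untouched registers and arrays.
\<close>

section \<open>Cyclic windows of the alphabet\<close>

text \<open>For letters and offsets below \<open>s\<close> this is \<open>(a - i) mod s\<close>, and
  \<open>unrotate_letter\<close> is \<open>(a + i) mod s\<close>. Both avoid \<open>mod\<close>,
  which the machine lacks; adding \<open>s\<close> first keeps the truncated subtraction
  exact.\<close>

definition rotate_letter :: "nat \<Rightarrow> nat \<Rightarrow> nat \<Rightarrow> nat" where
  "rotate_letter s i a = (if a < i then a + s else a) - i"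

definition unrotate_letter :: "nat \<Rightarrow> nat \<Rightarrow> nat \<Rightarrow> nat" where
  "unrotate_letter s i a = (if a + i < s then a + i else a + i - s)"

definition window :: "nat \<Rightarrow> nat \<Rightarrow> nat \<Rightarrow> nat list \<Rightarrow> nat list" where
  "window s l i A = filter (\<lambda>a. a < l) (map (rotate_letter s i) A)"

lemma unrotate_rotate_letter:
  "a < s \<Longrightarrow> i < s \<Longrightarrow> unrotate_letter s i (rotate_letter s i a) = a"
  by (auto simp: unrotate_letter_def rotate_letter_def)

lemma string_over_window: "string_over l (window s l i A)"
  by (auto simp: string_over_def window_def)

lemma length_window_le: "length (window s l i A) \<le> length A"
  unfolding window_def by (metis length_filter_le length_map)

lemma subseq_window: "subseq A B \<Longrightarrow> subseq (window s l i A) (window s l i B)"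
  unfolding window_def by (intro subseq_filter subseq_map)

lemma map_unrotate_window:
  assumes "string_over s A" "i < s"
  shows "map (unrotate_letter s i) (window s l i A) = filter (\<lambda>a. rotate_letter s i a < l) A"
  using assms unfolding window_def string_over_def
  by (induction A) (auto simp: unrotate_rotate_letter)

text \<open>The unrotated window is \<open>A\<close> with some letters filtered out, hence a
  subsequence of \<open>A\<close>. This carries the output for a window back to the original
  strings.\<close>

lemma subseq_unrotate_window:
  assumes "string_over s A" "i < s" "subseq C (window s l i A)"
  shows "subseq (map (unrotate_letter s i) C) A"
  by (metis assms map_unrotate_window subseq_filter_left subseq_map subseq_order.trans)

text \<open>For fixed \<open>a\<close> the map from \<open>i\<close> to \<open>(a - i) mod s\<close>
  is an involution on \<open>{..<s}\<close>, so it serves as its own inverse in the bijection with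
  \<open>{..<l}\<close>.\<close>

lemma card_windows_containing:
  assumes "a < s" "l < s"
  shows "card {i \<in> {..<s}. rotate_letter s i a < l} = l"
proof -
  have "bij_betw (\<lambda>i. rotate_letter s i a) {i \<in> {..<s}. rotate_letter s i a < l} {..<l}"
    by (rule bij_betw_byWitness[where f' = "\<lambda>i. rotate_letter s i a"])
      (use assms in \<open>auto simp: rotate_letter_def split: if_splits\<close>)
  then show ?thesis
    by (simp add: bij_betw_same_card)
qed

lemma sum_length_window:
  assumes "string_over s A" "l < s"
  shows "(\<Sum>i<s. length (window s l i A)) = l * length A"
  using assms(1)
proof (induction A)
  case Nil
  then show ?case by (simp add: window_def)
next
  case (Cons a A)
  have "(\<Sum>i<s. length (window s l i (a # A)))
      = (\<Sum>i<s. (if rotate_letter s i a < l then 1 else 0) + length (window s l i A))"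
    by (rule sum.cong) (auto simp: window_def)
  also have "\<dots> = card {i \<in> {..<s}. rotate_letter s i a < l} + (\<Sum>i<s. length (window s l i A))"
    by (simp add: sum.distrib sum.If_cases Int_def)
  also have "\<dots> = l + l * length A"
    using Cons card_windows_containing[of a s l] assms(2) by (simp add: string_over_def)
  finally show ?case by simp
qed

section \<open>Longest common subsequences and averaging over the windows\<close>

lemma finite_common_subseqs: "finite {C. common_subseq C A B}"
  by (rule finite_subset[of _ "set (subseqs A)"]) (auto simp: common_subseq_def subseqs_powset)

lemma lcs_attained: "\<exists>C. common_subseq C A B \<and> length C = lcs A B"
proof -
  have "common_subseq [] A B" by (simp add: common_subseq_def)
  then have "lcs A B \<in> length ` {C. common_subseq C A B}"
    unfolding lcs_def by (intro Max_in finite_imageI finite_common_subseqs) auto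
  then show ?thesis by auto
qed

lemma length_le_lcs: "common_subseq C A B \<Longrightarrow> length C \<le> lcs A B"
  unfolding lcs_def by (intro Max_ge finite_imageI finite_common_subseqs) auto

text \<open>Averaging: the windows of an optimal \<open>C\<close> have total length
  \<open>l * length C\<close>, so not all \<open>s\<close> of them can be shorter than the mean.
  Each is a common subsequence of the windows of \<open>A\<close> and \<open>B\<close>.\<close>

lemma exists_good_window:
  assumes "string_over s A" "l < s"
  shows "\<exists>i<s. l * lcs A B \<le> s * lcs (window s l i A) (window s l i B)"
proof (rule ccontr)
  assume neg: "\<not> ?thesis"
  obtain C where C: "common_subseq C A B" "length C = lcs A B"
    using lcs_attained by blast
  have over: "string_over s C"
    using assms(1) C(1) unfolding string_over_def common_subseq_def
    by (auto elim!: list_emb_set)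
  have "length (window s l i C) \<le> lcs (window s l i A) (window s l i B)" for i
    using C(1) by (intro length_le_lcs) (auto simp: common_subseq_def subseq_window)
  with neg have "s * length (window s l i C) < l * lcs A B" if "i < s" for i
    using that by (meson le_less_trans mult_le_mono2 not_le)
  then have "(\<Sum>i<s. s * length (window s l i C)) < (\<Sum>i<s. l * lcs A B)"
    using assms(2) by (intro sum_strict_mono) auto
  then show False
    by (simp add: sum_length_window[OF over assms(2)] C(2) flip: sum_distrib_left)
qed

section \<open>Weakest preconditions with time\<close>

definition runs :: "prog \<Rightarrow> state \<Rightarrow> (nat \<Rightarrow> state \<Rightarrow> bool) \<Rightarrow> bool" where
  "runs p \<sigma> Q \<longleftrightarrow> (\<exists>t \<tau>. exec p \<sigma> t \<tau> \<and> Q t \<tau>)"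

inductive_cases exec_SeqE: "exec (Seq p q) \<sigma> t \<tau>"

inductive_cases exec_If_LessE: "exec (If_Less x y p q) \<sigma> t \<tau>"

lemma runs_iff: "exec p \<sigma> t \<tau> \<Longrightarrow> runs p \<sigma> Q \<longleftrightarrow> Q t \<tau>"
  unfolding runs_def using exec_deterministic by blast

text \<open>Equivalences let straight-line code be executed symbolically by rewriting; for single
  instructions determinism supplies the forward direction. Such a rule for loops would unfold
  forever, so loops get introduction rules.\<close>

lemma runs_simps:
  "runs Skip \<sigma> Q \<longleftrightarrow> Q 1 \<sigma>"
  "runs (Const x c) \<sigma> Q \<longleftrightarrow> Q 1 (set_reg x c \<sigma>)"
  "runs (Add x y z) \<sigma> Q \<longleftrightarrow> Q 1 (set_reg x (reg \<sigma> y + reg \<sigma> z) \<sigma>)"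
  "runs (Sub x y z) \<sigma> Q \<longleftrightarrow> Q 1 (set_reg x (reg \<sigma> y - reg \<sigma> z) \<sigma>)"
  "runs (Load x a y) \<sigma> Q \<longleftrightarrow> Q 1 (set_reg x (mem \<sigma> a (reg \<sigma> y)) \<sigma>)"
  "runs (Store a x y) \<sigma> Q \<longleftrightarrow> Q 1 (set_mem a (reg \<sigma> x) (reg \<sigma> y) \<sigma>)"
  "runs (Seq p q) \<sigma> Q \<longleftrightarrow> runs p \<sigma> (\<lambda>t \<tau>. runs q \<tau> (\<lambda>u. Q (t + u)))"
  "runs (If_Less x y p q) \<sigma> Q \<longleftrightarrow>
     (if reg \<sigma> x < reg \<sigma> y then runs p \<sigma> (\<lambda>t. Q (Suc t)) else runs q \<sigma> (\<lambda>t. Q (Suc t)))"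
proof -
  show "runs (Seq p q) \<sigma> Q \<longleftrightarrow> runs p \<sigma> (\<lambda>t \<tau>. runs q \<tau> (\<lambda>u. Q (t + u)))"
    unfolding runs_def by (blast elim: exec_SeqE intro: exec.Seq)
  show "runs (If_Less x y p q) \<sigma> Q \<longleftrightarrow>
     (if reg \<sigma> x < reg \<sigma> y then runs p \<sigma> (\<lambda>t. Q (Suc t)) else runs q \<sigma> (\<lambda>t. Q (Suc t)))"
    unfolding runs_def
    by (auto elim!: exec_If_LessE
        dest: exec.If_True[of _ x y p _ _ q] exec.If_False[of _ x y q _ _ p])
qed (rule runs_iff exec.intros)+

lemma runs_mono: "runs p \<sigma> Q \<Longrightarrow> (\<And>t \<tau>. Q t \<tau> \<Longrightarrow> R t \<tau>) \<Longrightarrow> runs p \<sigma> R"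
  unfolding runs_def by blast

lemma runs_While_False: "\<not> reg \<sigma> x < reg \<sigma> y \<Longrightarrow> Q 1 \<sigma> \<Longrightarrow> runs (While_Less x y p) \<sigma> Q"
  unfolding runs_def by (blast intro: exec.intros)

lemma runs_While_True:
  assumes "reg \<sigma> x < reg \<sigma> y"
    and "runs p \<sigma> (\<lambda>t \<tau>. runs (While_Less x y p) \<tau> (\<lambda>u. Q (Suc (t + u))))"
  shows "runs (While_Less x y p) \<sigma> Q"
  using assms unfolding runs_def by (blast intro: exec.intros)

lemma exec_time_pos: "exec p \<sigma> t \<tau> \<Longrightarrow> 0 < t"
  by (induction rule: exec.induct) auto

lemma set_reg_sel [simp]:
  "reg (set_reg x v \<sigma>) = (reg \<sigma>)(x := v)" "mem (set_reg x v \<sigma>) = mem \<sigma>"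
  by (simp_all add: set_reg_def)

lemma set_mem_sel [simp]:
  "reg (set_mem a i v \<sigma>) = reg \<sigma>" "mem (set_mem a i v \<sigma>) = (mem \<sigma>)(a := (mem \<sigma> a)(i := v))"
  by (simp_all add: set_mem_def)

section \<open>Renaming registers and arrays\<close>

primrec rename :: "(nat \<Rightarrow> nat) \<Rightarrow> prog \<Rightarrow> prog" where
  "rename f Skip = Skip"
| "rename f (Const x c) = Const (f x) c"
| "rename f (Copy x y) = Copy (f x) (f y)"
| "rename f (Add x y z) = Add (f x) (f y) (f z)"
| "rename f (Sub x y z) = Sub (f x) (f y) (f z)"
| "rename f (Load x a y) = Load (f x) (f a) (f y)"
| "rename f (Store a x y) = Store (f a) (f x) (f y)"
| "rename f (Seq p q) = Seq (rename f p) (rename f q)"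
| "rename f (If_Less x y p q) = If_Less (f x) (f y) (rename f p) (rename f q)"
| "rename f (While_Less x y p) = While_Less (f x) (f y) (rename f p)"

text \<open>Cells of \<open>\<sigma>'\<close> outside \<open>range f\<close> are left free, so a
  copy can run inside a state holding other data; \<open>agree_off\<close> is the matching frame
  condition.\<close>

definition embeds :: "(nat \<Rightarrow> nat) \<Rightarrow> state \<Rightarrow> state \<Rightarrow> bool" where
  "embeds f \<sigma> \<sigma>' \<longleftrightarrow> (\<forall>x. reg \<sigma>' (f x) = reg \<sigma> x \<and> mem \<sigma>' (f x) = mem \<sigma> x)"

definition agree_off :: "nat set \<Rightarrow> state \<Rightarrow> state \<Rightarrow> bool" where
  "agree_off X \<sigma> \<tau> \<longleftrightarrow> (\<forall>x. x \<notin> X \<longrightarrow> reg \<tau> x = reg \<sigma> x \<and> mem \<tau> x = mem \<sigma> x)"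

lemma agree_off_trans: "agree_off X \<sigma> \<tau> \<Longrightarrow> agree_off X \<tau> \<upsilon> \<Longrightarrow> agree_off X \<sigma> \<upsilon>"
  by (simp add: agree_off_def)

lemma embedsD:
  assumes "embeds f \<sigma> \<sigma>'"
  shows "reg \<sigma>' (f x) = reg \<sigma> x" "mem \<sigma>' (f x) = mem \<sigma> x"
  using assms by (simp_all add: embeds_def)

lemma embeds_set_reg:
  "inj f \<Longrightarrow> embeds f \<sigma> \<sigma>' \<Longrightarrow> embeds f (set_reg x v \<sigma>) (set_reg (f x) v \<sigma>')"
  by (auto simp: embeds_def inj_eq)

lemma embeds_set_mem:
  "inj f \<Longrightarrow> embeds f \<sigma> \<sigma>' \<Longrightarrow> embeds f (set_mem a i v \<sigma>) (set_mem (f a) i v \<sigma>')"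
  by (auto simp: embeds_def inj_eq)

lemma agree_off_set:
  "agree_off (range f) \<sigma> (set_reg (f x) v \<sigma>)" "agree_off (range f) \<sigma> (set_mem (f x) i v \<sigma>)"
  by (auto simp: agree_off_def)

text \<open>A step-by-step simulation at equal cost. Injectivity of \<open>f\<close> ensures that
  writing one renamed cell leaves the image of every other cell alone.\<close>

lemma exec_rename:
  assumes "exec p \<sigma> t \<tau>" "inj f" "embeds f \<sigma> \<sigma>'"
  shows "\<exists>\<tau>'. exec (rename f p) \<sigma>' t \<tau>' \<and> embeds f \<tau> \<tau>' \<and> agree_off (range f) \<sigma>' \<tau>'"
  using assms
proof (induction arbitrary: \<sigma>' rule: exec.induct)
  case (Skip \<sigma>)
  then show ?case using exec.Skip[of \<sigma>'] by (auto simp: agree_off_def)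
next
  case (Const x c \<sigma>)
  then show ?case
    using exec.Const[of "f x" c \<sigma>']
    by (intro exI[of _ "set_reg (f x) c \<sigma>'"])
      (simp add: embeds_set_reg agree_off_set)
next
  case (Copy x y \<sigma>)
  then show ?case
    using exec.Copy[of "f x" "f y" \<sigma>']
    by (intro exI[of _ "set_reg (f x) (reg \<sigma> y) \<sigma>'"])
      (simp add: embedsD[OF Copy.prems(2)] embeds_set_reg agree_off_set)
next
  case (Add x y z \<sigma>)
  then show ?case
    using exec.Add[of "f x" "f y" "f z" \<sigma>']
    by (intro exI[of _ "set_reg (f x) (reg \<sigma> y + reg \<sigma> z) \<sigma>'"])
      (simp add: embedsD[OF Add.prems(2)] embeds_set_reg agree_off_set)
next
  case (Sub x y z \<sigma>)
  then show ?case
    using exec.Sub[of "f x" "f y" "f z" \<sigma>']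
    by (intro exI[of _ "set_reg (f x) (reg \<sigma> y - reg \<sigma> z) \<sigma>'"])
      (simp add: embedsD[OF Sub.prems(2)] embeds_set_reg agree_off_set)
next
  case (Load x a y \<sigma>)
  then show ?case
    using exec.Load[of "f x" "f a" "f y" \<sigma>']
    by (intro exI[of _ "set_reg (f x) (mem \<sigma> a (reg \<sigma> y)) \<sigma>'"])
      (simp add: embedsD[OF Load.prems(2)] embeds_set_reg agree_off_set)
next
  case (Store a x y \<sigma>)
  then show ?case
    using exec.Store[of "f a" "f x" "f y" \<sigma>']
    by (intro exI[of _ "set_mem (f a) (reg \<sigma> x) (reg \<sigma> y) \<sigma>'"])
      (simp add: embedsD[OF Store.prems(2)] embeds_set_mem agree_off_set)
next
  case (Seq p \<sigma> t \<tau> q u \<upsilon>)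
  then show ?case by (auto intro: exec.intros) (meson agree_off_trans exec.Seq)
next
  case (If_True \<sigma> x y p t \<tau> q)
  then obtain \<tau>' where "exec (rename f p) \<sigma>' t \<tau>'" "embeds f \<tau> \<tau>'" "agree_off (range f) \<sigma>' \<tau>'"
    by blast
  moreover have "reg \<sigma>' (f x) < reg \<sigma>' (f y)"
    using If_True.hyps embedsD[OF If_True.prems(2)] by simp
  ultimately show ?case
    using exec.If_True[of \<sigma>' "f x" "f y"] by (metis rename.simps(9))
next
  case (If_False \<sigma> x y q t \<tau> p)
  then obtain \<tau>' where "exec (rename f q) \<sigma>' t \<tau>'" "embeds f \<tau> \<tau>'" "agree_off (range f) \<sigma>' \<tau>'"
    by blast
  moreover have "\<not> reg \<sigma>' (f x) < reg \<sigma>' (f y)"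
    using If_False.hyps embedsD[OF If_False.prems(2)] by simp
  ultimately show ?case
    using exec.If_False[of \<sigma>' "f x" "f y"] by (metis rename.simps(9))
next
  case (While_False \<sigma> x y p)
  then show ?case
    using exec.While_False[of \<sigma>' "f x" "f y"] by (auto simp: agree_off_def embeds_def)
next
  case (While_True \<sigma> x y p t \<tau> u \<upsilon>)
  have "reg \<sigma>' (f x) < reg \<sigma>' (f y)"
    using While_True.hyps While_True.prems by (simp add: embeds_def)
  moreover obtain \<tau>' where "exec (rename f p) \<sigma>' t \<tau>'" "embeds f \<tau> \<tau>'" "agree_off (range f) \<sigma>' \<tau>'"
    using While_True.IH(1) While_True.prems by blast
  moreover obtain \<upsilon>' where "exec (rename f (While_Less x y p)) \<tau>' u \<upsilon>'" "embeds f \<upsilon> \<upsilon>'"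
    "agree_off (range f) \<tau>' \<upsilon>'"
    using While_True.IH(2) While_True.prems \<open>embeds f \<tau> \<tau>'\<close> by blast
  ultimately show ?case
    using exec.While_True[of \<sigma>' "f x" "f y"] agree_off_trans by (metis rename.simps(10))
qed

section \<open>Scanning an array\<close>

text \<open>
  Register \<open>3\<close> is the loop counter, register \<open>4\<close> holds the current letter and register \<open>5\<close> the
  constant \<open>1\<close>. The scan applies \<open>h\<close> to the letters of array \<open>a\<close> (length in register \<open>r\<close>) and
  appends the results below register \<open>m\<close> to array \<open>d\<close> (length in register \<open>e\<close>).
\<close>

definition scan_body :: "nat \<Rightarrow> prog \<Rightarrow> nat \<Rightarrow> nat \<Rightarrow> nat \<Rightarrow> prog" where
  "scan_body a h m d e =
     Seq (Load 4 a 3) (Seq h (Seq (If_Less 4 m (Seq (Store d e 4) (Add e e 5)) Skip) (Add 3 3 5)))"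

definition scan :: "nat \<Rightarrow> nat \<Rightarrow> prog \<Rightarrow> nat \<Rightarrow> nat \<Rightarrow> nat \<Rightarrow> prog" where
  "scan a r h m d e = Seq (Const 3 0) (While_Less 3 r (scan_body a h m d e))"

definition write_at :: "nat \<Rightarrow> nat list \<Rightarrow> (nat \<Rightarrow> nat) \<Rightarrow> nat \<Rightarrow> nat" where
  "write_at k ys m j = (if k \<le> j \<and> j < k + length ys then ys ! (j - k) else m j)"

lemma write_at_Nil [simp]: "write_at k [] m = m"
  by (auto simp: write_at_def)

lemma write_at_Cons: "write_at k (y # ys) m = write_at (Suc k) ys (m(k := y))"
proof
  fix j
  show "write_at k (y # ys) m j = write_at (Suc k) ys (m(k := y)) j"
    by (cases "j = k") (auto simp: write_at_def nth_Cons' Suc_le_eq)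
qed

text \<open>Here \<open>xs\<close> is the unread suffix, so the induction starts at an arbitrary
  counter and destination length. The letter program \<open>h\<close> may rely on the constants
  \<open>\<rho>\<close> in the registers \<open>X\<close>, which the loop never changes. A letter
  costs at most 9 steps: guard, load, 3 for \<open>h\<close>, comparison, store and two additions.
  The last \<open>1\<close> is the failing guard.\<close>

lemma runs_scan_loop:
  assumes h: "\<And>\<sigma> Q. (\<And>x. x \<in> X \<Longrightarrow> reg \<sigma> x = \<rho> x) \<Longrightarrow>
      (\<And>t. t \<le> 3 \<Longrightarrow> Q t (set_reg 4 (g (reg \<sigma> 4)) \<sigma>)) \<Longrightarrow> runs h \<sigma> Q"
    and X: "3 \<notin> X" "4 \<notin> X" "e \<notin> X" "m \<in> X" "5 \<in> X" "\<rho> 5 = 1"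
    and \<rho>: "\<And>x. x \<in> X \<Longrightarrow> reg \<sigma> x = \<rho> x"
    and regs: "r \<notin> {3, 4, e}" "e \<notin> {3, 4}" "d \<noteq> a"
    and src: "reg \<sigma> r = reg \<sigma> 3 + length xs" "\<And>j. j < length xs \<Longrightarrow> mem \<sigma> a (reg \<sigma> 3 + j) = xs ! j"
    and Q: "\<And>t \<tau>. t \<le> 9 * length xs + 1 \<Longrightarrow>
      reg \<tau> e = reg \<sigma> e + length (filter (\<lambda>v. v < \<rho> m) (map g xs)) \<Longrightarrow>
      mem \<tau> d = write_at (reg \<sigma> e) (filter (\<lambda>v. v < \<rho> m) (map g xs)) (mem \<sigma> d) \<Longrightarrow>
      (\<And>x. x \<notin> {3, 4, e} \<Longrightarrow> reg \<tau> x = reg \<sigma> x) \<Longrightarrow> (\<And>x. x \<noteq> d \<Longrightarrow> mem \<tau> x = mem \<sigma> x) \<Longrightarrow> Q t \<tau>"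
  shows "runs (While_Less 3 r (scan_body a h m d e)) \<sigma> Q"
  using \<rho> src Q
proof (induction xs arbitrary: \<sigma> Q)
  case Nil
  show ?case
    by (rule runs_While_False) (use Nil in auto)
next
  case (Cons v vs)
  note \<rho> = Cons.prems(1) and src = Cons.prems(2,3) and Q = Cons.prems(4)
  have v: "mem \<sigma> a (reg \<sigma> 3) = v"
    using src(2)[of 0] by simp
  have vs: "mem \<sigma> a (Suc (reg \<sigma> 3 + j)) = vs ! j" if "j < length vs" for j
    using src(2)[of "Suc j"] that by simp
  have neq: "m \<noteq> 3" "m \<noteq> 4" "m \<noteq> e" "e \<noteq> 5" "r \<noteq> 3" "r \<noteq> 4" "r \<noteq> e" "e \<noteq> 3" "e \<noteq> 4" "a \<noteq> d"
    using X regs by auto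
  have const: "reg \<sigma> 5 = 1" "reg \<sigma> m = \<rho> m"
    using X \<rho> by auto
  show ?case
  proof (rule runs_While_True)
    show "reg \<sigma> 3 < reg \<sigma> r" using src by simp
    show "runs (scan_body a h m d e) \<sigma>
      (\<lambda>t \<tau>. runs (While_Less 3 r (scan_body a h m d e)) \<tau> (\<lambda>u. Q (Suc (t + u))))"
      unfolding scan_body_def[of a h m d e] runs_simps
    proof (rule h, goal_cases)
      case (1 x)
      then show ?case using X \<rho> by auto
    next
      case (2 t)
      show ?case
      proof (cases "g v < \<rho> m")
        case True
        then show ?thesis
          using neq const v apply (simp add: runs_simps flip: scan_body_def)
          apply (rule Cons.IH)
          subgoal using X \<rho> by auto
          subgoal using src by simp
          subgoal using vs by simp
          subgoal using 2 by (intro Q) (auto simp: write_at_Cons fun_upd_def)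
          done
      next
        case False
        then show ?thesis
          using neq const v apply (simp add: runs_simps flip: scan_body_def)
          apply (rule Cons.IH)
          subgoal using X \<rho> by auto
          subgoal using src by simp
          subgoal using vs by simp
          subgoal using 2 by (intro Q) auto
          done
      qed
    qed
  qed
qed

lemma runs_scan:
  assumes h: "\<And>\<sigma> Q. (\<And>x. x \<in> X \<Longrightarrow> reg \<sigma> x = \<rho> x) \<Longrightarrow>
      (\<And>t. t \<le> 3 \<Longrightarrow> Q t (set_reg 4 (g (reg \<sigma> 4)) \<sigma>)) \<Longrightarrow> runs h \<sigma> Q"
    and X: "3 \<notin> X" "4 \<notin> X" "e \<notin> X" "m \<in> X" "5 \<in> X" "\<rho> 5 = 1"
    and \<rho>: "\<And>x. x \<in> X \<Longrightarrow> reg \<sigma> x = \<rho> x"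
    and regs: "r \<notin> {3, 4, e}" "e \<notin> {3, 4}" "d \<noteq> a"
    and src: "reg \<sigma> r = length xs" "\<And>j. j < length xs \<Longrightarrow> mem \<sigma> a j = xs ! j"
    and dst: "reg \<sigma> e = 0"
    and Q: "\<And>t \<tau>. t \<le> 9 * length xs + 2 \<Longrightarrow>
      reg \<tau> e = length (filter (\<lambda>v. v < \<rho> m) (map g xs)) \<Longrightarrow>
      mem \<tau> d = write_at 0 (filter (\<lambda>v. v < \<rho> m) (map g xs)) (mem \<sigma> d) \<Longrightarrow>
      (\<And>x. x \<notin> {3, 4, e} \<Longrightarrow> reg \<tau> x = reg \<sigma> x) \<Longrightarrow> (\<And>x. x \<noteq> d \<Longrightarrow> mem \<tau> x = mem \<sigma> x) \<Longrightarrow> Q t \<tau>"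
  shows "runs (scan a r h m d e) \<sigma> Q"
  unfolding scan_def runs_simps
proof (rule runs_scan_loop[where X = X and \<rho> = \<rho> and g = g and xs = xs], goal_cases)
  case (1 \<sigma>' Q')
  then show ?case by (rule h)
next
  case (14 t \<tau>)
  then show ?case using dst regs by (intro Q) auto
qed (use X \<rho> regs src in auto)

section \<open>The program for the large alphabet\<close>

text \<open>
  Registers \<open>6\<close>, \<open>7\<close>, \<open>8\<close> hold \<open>i\<close>, \<open>s\<close>, \<open>l\<close>; the \<open>i\<close>-th copy of the given program uses
  the registers and arrays in the range of \<open>bank s i\<close>.
\<close>

definition bank :: "nat \<Rightarrow> nat \<Rightarrow> nat \<Rightarrow> nat" where
  "bank s i x = 9 + (s * x + i)"

definition rotate_prog :: prog where
  "rotate_prog = Seq (If_Less 4 6 (Add 4 4 7) Skip) (Sub 4 4 6)"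

definition unrotate_prog :: prog where
  "unrotate_prog = Seq (Add 4 4 6) (If_Less 4 7 Skip (Sub 4 4 7))"

text \<open>The input scans use the limit \<open>l\<close> in register 8 to cut out the window; the
  scan back uses the limit \<open>s\<close> in register 7, which admits every letter of the
  alphabet. The output is replaced only by a strictly longer one; stale cells of array 2 lie beyond
  the length in register 2.\<close>

definition phase :: "nat \<Rightarrow> nat \<Rightarrow> prog \<Rightarrow> nat \<Rightarrow> prog" where
  "phase s l P i =
     Seq (Const 5 1) (Seq (Const 6 i) (Seq (Const 7 s) (Seq (Const 8 l)
     (Seq (scan 0 0 rotate_prog 8 (bank s i 0) (bank s i 0))
     (Seq (scan 1 1 rotate_prog 8 (bank s i 1) (bank s i 1))
     (Seq (rename (bank s i) P)
     (If_Less 2 (bank s i 2)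
       (Seq (Const 2 0) (scan (bank s i 2) (bank s i 2) unrotate_prog 7 2 2))
       Skip)))))))"

primrec phases :: "nat \<Rightarrow> nat \<Rightarrow> prog \<Rightarrow> nat \<Rightarrow> prog" where
  "phases s l P 0 = Skip"
| "phases s l P (Suc k) = Seq (phases s l P k) (phase s l P k)"

section \<open>Correctness and running time of the phases\<close>

lemma inj_bank: "i < s \<Longrightarrow> inj (bank s i)"
  by (auto simp: bank_def inj_def)

lemma bank_ge: "9 \<le> bank s i x"
  by (simp add: bank_def)

text \<open>Division by \<open>s\<close> recovers \<open>x\<close> as quotient and \<open>i\<close>
  as remainder. Interleaving by residues gives each copy room for all names, whatever the given
  program mentions.\<close>

lemma bank_eq_iff: "i < s \<Longrightarrow> j < s \<Longrightarrow> bank s i x = bank s j y \<longleftrightarrow> i = j \<and> x = y"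
proof
  assume "i < s" "j < s" "bank s i x = bank s j y"
  then have eq: "s * x + i = s * y + j" by (simp add: bank_def)
  then have "(s * x + i) mod s = (s * y + j) mod s" by simp
  then have "i = j" using \<open>i < s\<close> \<open>j < s\<close> by simp
  then show "i = j \<and> x = y" using eq \<open>i < s\<close> by simp
qed simp

text \<open>Both branches take exactly 3 steps. The default value 1 of the function stands for
  register 5, the increment of the scan.\<close>

lemma runs_rotate_prog:
  assumes "\<And>x. x \<in> {5, 6, 7, 8} \<Longrightarrow> reg \<sigma> x = ((\<lambda>_. 1)(6 := i, 7 := s, 8 := l)) x"
    and "\<And>t. t \<le> 3 \<Longrightarrow> Q t (set_reg 4 (rotate_letter s i (reg \<sigma> 4)) \<sigma>)"
  shows "runs rotate_prog \<sigma> Q"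
proof -
  have "reg \<sigma> 6 = i" "reg \<sigma> 7 = s"
    using assms(1)[of 6] assms(1)[of 7] by simp_all
  then show ?thesis
    using assms(2)[of 3]
    by (auto simp: rotate_prog_def runs_simps rotate_letter_def set_reg_def numeral_eq_Suc)
qed

lemma runs_unrotate_prog:
  assumes "\<And>x. x \<in> {5, 6, 7, 8} \<Longrightarrow> reg \<sigma> x = ((\<lambda>_. 1)(6 := i, 7 := s, 8 := l)) x"
    and "\<And>t. t \<le> 3 \<Longrightarrow> Q t (set_reg 4 (unrotate_letter s i (reg \<sigma> 4)) \<sigma>)"
  shows "runs unrotate_prog \<sigma> Q"
proof -
  have "reg \<sigma> 6 = i" "reg \<sigma> 7 = s"
    using assms(1)[of 6] assms(1)[of 7] by simp_all
  then show ?thesis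
    using assms(2)[of 3]
    by (auto simp: unrotate_prog_def runs_simps unrotate_letter_def set_reg_def numeral_eq_Suc)
qed

text \<open>The zero clause lets the next copy start from a genuine input state. The last clause
  survives later phases because the output never gets shorter.\<close>

definition phase_inv :: "nat \<Rightarrow> nat \<Rightarrow> nat list \<Rightarrow> nat list \<Rightarrow> real \<Rightarrow> nat \<Rightarrow> state \<Rightarrow> bool" where
  "phase_inv s l A B c k \<sigma> \<longleftrightarrow>
     reg \<sigma> 0 = length A \<and> reg \<sigma> 1 = length B \<and> mem \<sigma> 0 = array_of A \<and> mem \<sigma> 1 = array_of B \<and>
     (\<forall>i x. k \<le> i \<longrightarrow> i < s \<longrightarrow> reg \<sigma> (bank s i x) = 0 \<and> mem \<sigma> (bank s i x) = (\<lambda>_. 0)) \<and>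
     common_subseq (output_string \<sigma>) A B \<and>
     (\<forall>i<k. c * real (lcs (window s l i A) (window s l i B)) \<le> real (length (output_string \<sigma>)))"

lemma phase_inv_input: "phase_inv s l A B c 0 (input_state A B)"
  by (auto simp: phase_inv_def input_state_def output_string_def common_subseq_def bank_def)

lemma write_at_zero: "write_at 0 ys (\<lambda>_. 0) = array_of ys"
  by (auto simp: write_at_def array_of_def)

lemma map_write_at: "map (write_at 0 ys m) [0..<length ys] = ys"
  by (rule nth_equalityI) (auto simp: write_at_def)

text \<open>The bound adds 4 constants, two scans of at most \<open>9 * n + 2\<close>, the
  \<open>t\<close> steps of the copy, and \<open>9 * n + 4\<close> for the comparison, the reset of
  register 2 and the scan back.\<close>

lemma runs_phase:
  assumes inv: "phase_inv s l A B c k \<sigma>"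
    and AB: "string_over s A" "string_over s B" "length A \<le> n" "length B \<le> n"
    and kls: "k < s" "l < s"
    and P: "exec P (input_state (window s l k A) (window s l k B)) t \<upsilon>"
    and sub: "common_subseq (output_string \<upsilon>) (window s l k A) (window s l k B)"
    and len: "c * real (lcs (window s l k A) (window s l k B)) \<le> real (length (output_string \<upsilon>))"
  shows "runs (phase s l P k) \<sigma> (\<lambda>u \<tau>. u \<le> 27 * n + 12 + t \<and> phase_inv s l A B c (Suc k) \<tau>)"
proof -
  let ?A = "window s l k A" and ?B = "window s l k B" and ?b = "bank s k"
  let ?X = "{5, 6, 7, 8 :: nat}" and ?\<rho> = "(\<lambda>_::nat. 1)(6 := k, 7 := s, 8 := l)"
  let ?D = "map (unrotate_letter s k) (output_string \<upsilon>)"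
  have b: "?b x \<noteq> j" "j \<noteq> ?b x" if "j < 9" for x j
    using bank_ge[of s k x] that by auto
  have b_eq: "?b x = ?b y \<longleftrightarrow> x = y" for x y
    using bank_eq_iff[OF kls(1) kls(1)] by simp
  have off: "bank s i x \<notin> range ?b" if "k < i" "i < s" for i x
    using bank_eq_iff[OF that(2) kls(1)] that(1) by auto
  have small: "j \<notin> range ?b" if "j < 9" for j
    using b[OF that] by auto
  note inv = inv[unfolded phase_inv_def]
  have zero: "reg \<sigma> (?b x) = 0" "mem \<sigma> (?b x) = (\<lambda>_. 0)" for x
    using inv kls(1) by auto
  have inp: "reg \<sigma> 0 = length A" "reg \<sigma> 1 = length B" "mem \<sigma> 0 = array_of A" "mem \<sigma> 1 = array_of B"
    using inv by auto
  have [simp]: "j < length ys \<Longrightarrow> array_of ys j = ys ! j" for ys j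
    by (simp add: array_of_def)
  have D: "common_subseq ?D A B"
    using sub AB kls(1) by (auto simp: common_subseq_def intro: subseq_unrotate_window)
  have D_len: "length (output_string \<upsilon>) = reg \<upsilon> 2" "reg \<upsilon> 2 \<le> n"
  proof -
    show "length (output_string \<upsilon>) = reg \<upsilon> 2" by (simp add: output_string_def)
    then show "reg \<upsilon> 2 \<le> n"
      using sub length_window_le[of s l k A] AB(3) list_emb_length
      by (fastforce simp: common_subseq_def)
  qed
  have D_over: "\<forall>v \<in> set ?D. v < s"
    using D AB(1) by (auto simp: common_subseq_def string_over_def elim!: list_emb_set)
  define \<sigma>0 where "\<sigma>0 = set_reg 8 l (set_reg 7 s (set_reg 6 k (set_reg 5 1 \<sigma>)))"
  \<comment> \<open>Both outcomes of the length comparison end here. Only the cells 2 to 8 and the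
    bank of copy \<open>k\<close> may have changed, and the longer string is the output.\<close>
  have fin: "phase_inv s l A B c (Suc k) \<tau>"
    if same: "\<And>x. x \<notin> range ?b \<Longrightarrow> x < 2 \<or> 9 \<le> x \<Longrightarrow> reg \<tau> x = reg \<sigma> x \<and> mem \<tau> x = mem \<sigma> x"
      and out: "output_string \<tau> = (if reg \<sigma> 2 < reg \<upsilon> 2 then ?D else output_string \<sigma>)" for \<tau>
  proof -
    have long: "length (output_string \<sigma>) \<le> length (output_string \<tau>)"
      "length (output_string \<upsilon>) \<le> length (output_string \<tau>)"
      using out by (auto simp: output_string_def)
    have "c * real (lcs (window s l i A) (window s l i B)) \<le> real (length (output_string \<tau>))"
      if "i < Suc k" for i
    proof (cases "i = k")
      case True
      show ?thesis unfolding True using len long(2) by linarith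
    next
      case False
      then have "c * real (lcs (window s l i A) (window s l i B)) \<le> real (length (output_string \<sigma>))"
        using inv that by simp
      then show ?thesis using long(1) by linarith
    qed
    moreover have "common_subseq (output_string \<tau>) A B"
      using out D inv by simp
    moreover have "reg \<tau> (bank s i x) = 0 \<and> mem \<tau> (bank s i x) = (\<lambda>_. 0)" if "Suc k \<le> i" "i < s" for i x
      using same[OF off] inv that by (simp add: bank_ge)
    ultimately show ?thesis
      using inp same[OF small, of 0] same[OF small, of 1] by (simp add: phase_inv_def)
  qed
  show ?thesis
    unfolding phase_def runs_simps \<sigma>0_def[symmetric]
  proof (rule runs_scan[where X = ?X and \<rho> = ?\<rho> and g = "rotate_letter s k" and xs = A,
        OF runs_rotate_prog], goal_cases)
    \<comment> \<open>Goal 16 is the rest of the phase after this scan; the other goals are side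
      conditions of the scan.\<close>
    case (16 t1 \<sigma>1)
    have \<sigma>1: "reg \<sigma>1 (?b 0) = length ?A" "mem \<sigma>1 (?b 0) = array_of ?A"
      "\<And>x. x \<notin> {3, 4, ?b 0} \<Longrightarrow> reg \<sigma>1 x = reg \<sigma>0 x" "\<And>x. x \<noteq> ?b 0 \<Longrightarrow> mem \<sigma>1 x = mem \<sigma> x"
      using 16 by (simp_all add: window_def \<sigma>0_def zero write_at_zero)
    show ?case
    proof (rule runs_scan[where X = ?X and \<rho> = ?\<rho> and g = "rotate_letter s k" and xs = B,
          OF runs_rotate_prog], goal_cases)
      case (16 t2 \<sigma>2)
      have \<sigma>2: "reg \<sigma>2 (?b 1) = length ?B" "mem \<sigma>2 (?b 1) = array_of ?B"
        "\<And>x. x \<notin> {3, 4, ?b 1} \<Longrightarrow> reg \<sigma>2 x = reg \<sigma>1 x" "\<And>x. x \<noteq> ?b 1 \<Longrightarrow> mem \<sigma>2 x = mem \<sigma>1 x"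
        using 16 by (simp_all add: window_def \<sigma>0_def \<sigma>1 b b_eq zero write_at_zero)
      \<comment> \<open>The scans filled the images of 0 and 1, and the invariant keeps the rest of
        the bank zero, so the copy sees exactly its input state.\<close>
      have "reg \<sigma>2 (?b x) = reg (input_state ?A ?B) x \<and> mem \<sigma>2 (?b x) = mem (input_state ?A ?B) x" for x
      proof -
        consider "x = 0" | "x = 1" | "x \<noteq> 0" "x \<noteq> 1" by blast
        then show ?thesis
          by cases (use \<sigma>2(1,2) in \<open>simp_all add: \<sigma>2(3,4) \<sigma>1 \<sigma>0_def b b_eq zero input_state_def\<close>)
      qed
      then have "embeds ?b (input_state ?A ?B) \<sigma>2"
        by (simp add: embeds_def)
      then obtain \<sigma>3 where \<sigma>3: "exec (rename ?b P) \<sigma>2 t \<sigma>3" "embeds ?b \<upsilon> \<sigma>3"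
        "agree_off (range ?b) \<sigma>2 \<sigma>3"
        using exec_rename[OF P inj_bank[OF kls(1)]] by blast
      have reg3: "reg \<sigma>3 x = reg \<sigma>0 x" if "x \<notin> range ?b" "x \<noteq> 3" "x \<noteq> 4" for x
      proof -
        have "x \<noteq> ?b 0" "x \<noteq> ?b 1" using that by blast+
        then show ?thesis
          using \<sigma>3(3) that \<sigma>2(3)[of x] \<sigma>1(3)[of x] by (simp add: agree_off_def)
      qed
      have mem3: "mem \<sigma>3 x = mem \<sigma> x" if "x \<notin> range ?b" for x
      proof -
        have "x \<noteq> ?b 0" "x \<noteq> ?b 1" using that by blast+
        then show ?thesis
          using \<sigma>3(3) that \<sigma>2(4)[of x] \<sigma>1(4)[of x] by (simp add: agree_off_def)
      qed
      have up: "reg \<sigma>3 (?b x) = reg \<upsilon> x" "mem \<sigma>3 (?b x) = mem \<upsilon> x" for x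
        using \<sigma>3(2) by (auto simp: embeds_def)
      have two: "reg \<sigma>3 2 = reg \<sigma> 2"
        by (simp add: reg3 small \<sigma>0_def)
      have tail: "runs (If_Less 2 (?b 2)
          (Seq (Const 2 0) (scan (?b 2) (?b 2) unrotate_prog 7 2 2)) Skip) \<sigma>3
          (\<lambda>u \<tau>. u \<le> 9 * n + 4 \<and> phase_inv s l A B c (Suc k) \<tau>)"
      proof (cases "reg \<sigma> 2 < reg \<upsilon> 2")
        case False
        have "phase_inv s l A B c (Suc k) \<sigma>3"
        proof (rule fin)
          show "output_string \<sigma>3 = (if reg \<sigma> 2 < reg \<upsilon> 2 then ?D else output_string \<sigma>)"
            using False by (simp add: output_string_def two mem3 small)
        qed (auto simp: reg3 mem3 \<sigma>0_def)
        then show ?thesis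
          using False by (simp add: runs_simps up two)
      next
        case True
        have "runs (scan (?b 2) (?b 2) unrotate_prog 7 2 2) (set_reg 2 0 \<sigma>3)
          (\<lambda>u \<tau>. u \<le> 9 * n + 2 \<and> phase_inv s l A B c (Suc k) \<tau>)"
        proof (rule runs_scan[where X = ?X and \<rho> = ?\<rho> and g = "unrotate_letter s k"
              and xs = "output_string \<upsilon>", OF runs_unrotate_prog], goal_cases)
          case (16 u \<tau>)
          \<comment> \<open>The unrotated letters occur in \<open>A\<close> and so lie below
            \<open>s\<close>: the limit in register 7 removes none of them.\<close>
          have all: "filter (\<lambda>v. v < ?\<rho> 7) ?D = ?D"
            using D_over by (simp add: filter_id_conv)
          have "output_string \<tau> = ?D"
            using 16(2,3) unfolding output_string_def[of \<tau>] all by (simp only: map_write_at)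
          then have "phase_inv s l A B c (Suc k) \<tau>"
            using True 16(4,5) by (intro fin) (auto simp: reg3 mem3 \<sigma>0_def)
          then show ?case
            using 16(1) D_len by simp
        qed (auto simp: up b reg3 small \<sigma>0_def output_string_def)
        then show ?thesis
          using True by (simp add: runs_simps up two)
      qed
      have "t1 + t2 \<le> 18 * n + 4"
        using 16(1) \<open>t1 \<le> 9 * length A + 2\<close> AB(3,4) by linarith
      with tail have "runs (If_Less 2 (?b 2)
          (Seq (Const 2 0) (scan (?b 2) (?b 2) unrotate_prog 7 2 2)) Skip) \<sigma>3
          (\<lambda>u \<tau>. 1 + (1 + (1 + (1 + (t1 + (t2 + (t + u)))))) \<le> 27 * n + 12 + t \<and>
            phase_inv s l A B c (Suc k) \<tau>)"
        by (elim runs_mono) auto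
      then show ?case
        using \<sigma>3(1) unfolding runs_def[of "rename ?b P"] runs_simps by blast
    qed (auto simp: \<sigma>1 \<sigma>0_def b b_eq zero inp[unfolded One_nat_def])
  qed (auto simp: \<sigma>0_def b zero inp)
qed

text \<open>\<open>M\<close> bounds the given program on all windows at once; the leading
  \<open>1\<close> pays for the initial \<open>Skip\<close>.\<close>

lemma runs_phases:
  assumes AB: "string_over s A" "string_over s B" "length A \<le> n" "length B \<le> n"
    and ls: "l < s"
    and P: "\<And>k. k < s \<Longrightarrow> \<exists>t \<upsilon>. exec P (input_state (window s l k A) (window s l k B)) t \<upsilon> \<and>
      real t \<le> M \<and> common_subseq (output_string \<upsilon>) (window s l k A) (window s l k B) \<and>
      c * real (lcs (window s l k A) (window s l k B)) \<le> real (length (output_string \<upsilon>))"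
    and k: "k \<le> s"
  shows "runs (phases s l P k) (input_state A B)
    (\<lambda>u \<tau>. real u \<le> 1 + real k * (27 * real n + 12 + M) \<and> phase_inv s l A B c k \<tau>)"
  using k
proof (induction k)
  case 0
  then show ?case by (simp add: runs_simps phase_inv_input)
next
  case (Suc k)
  obtain t \<upsilon> where "exec P (input_state (window s l k A) (window s l k B)) t \<upsilon>"
    and t: "real t \<le> M" and "common_subseq (output_string \<upsilon>) (window s l k A) (window s l k B)"
    "c * real (lcs (window s l k A) (window s l k B)) \<le> real (length (output_string \<upsilon>))"
    using P[of k] Suc.prems by auto
  note step = runs_phase[OF _ AB _ ls this(1,3,4)]
  have "runs (phases s l P k) (input_state A B)
    (\<lambda>u \<tau>. real u \<le> 1 + real k * (27 * real n + 12 + M) \<and> phase_inv s l A B c k \<tau>)"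
    using Suc by simp
  then show ?case
    unfolding phases.simps runs_simps
  proof (rule runs_mono)
    fix u \<tau>
    assume u: "real u \<le> 1 + real k * (27 * real n + 12 + M) \<and> phase_inv s l A B c k \<tau>"
    have "runs (phase s l P k) \<tau> (\<lambda>u \<tau>. u \<le> 27 * n + 12 + t \<and> phase_inv s l A B c (Suc k) \<tau>)"
      using step u Suc.prems by simp
    then show "runs (phase s l P k) \<tau> (\<lambda>v \<tau>. real (u + v) \<le> 1 + real (Suc k) * (27 * real n + 12 + M) \<and>
        phase_inv s l A B c (Suc k) \<tau>)"
    proof (rule runs_mono)
      fix v \<tau>'
      assume v: "v \<le> 27 * n + 12 + t \<and> phase_inv s l A B c (Suc k) \<tau>'"
      then have "real v \<le> 27 * real n + 12 + real t" by linarith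
      then show "real (u + v) \<le> 1 + real (Suc k) * (27 * real n + 12 + M) \<and>
        phase_inv s l A B c (Suc k) \<tau>'"
        using u v t by (simp add: algebra_simps)
    qed
  qed
qed

section \<open>Approximation ratio and total running time\<close>

lemma approximation_lift:
  fixes s l :: nat and \<epsilon> :: real
  assumes sl: "l < s" "2 \<le> l" and \<epsilon>: "0 \<le> \<epsilon>" "\<epsilon> < real l"
    and P: "approximates_lcs P l (1 / (real l - \<epsilon>))" "runs_in_time P l T"
    and AB: "string_over s A" "string_over s B" "length A \<le> n" "length B \<le> n"
  shows "\<exists>t \<sigma>. exec (phases s l P s) (input_state A B) t \<sigma> \<and> common_subseq (output_string \<sigma>) A B \<and>
    1 / (real s * (1 - \<epsilon> / real l)) * real (lcs A B) \<le> real (length (output_string \<sigma>)) \<and>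
    real t \<le> 28 * ((real n + T n) * real (s choose l))"
proof -
  let ?c = "1 / (real l - \<epsilon>)"
  have PT: "\<exists>t \<upsilon>. exec P (input_state (window s l k A) (window s l k B)) t \<upsilon> \<and> real t \<le> T n \<and>
      common_subseq (output_string \<upsilon>) (window s l k A) (window s l k B) \<and>
      ?c * real (lcs (window s l k A) (window s l k B)) \<le> real (length (output_string \<upsilon>))" for k
  proof -
    have "length (window s l k A) \<le> n" "length (window s l k B) \<le> n"
      using length_window_le AB(3,4) le_trans by blast+
    then obtain t \<upsilon> where "exec P (input_state (window s l k A) (window s l k B)) t \<upsilon>" "real t \<le> T n"
      using P(2) string_over_window unfolding runs_in_time_def by meson
    moreover obtain t' \<upsilon>' where "exec P (input_state (window s l k A) (window s l k B)) t' \<upsilon>'"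
      "common_subseq (output_string \<upsilon>') (window s l k A) (window s l k B)"
      "?c * real (lcs (window s l k A) (window s l k B)) \<le> real (length (output_string \<upsilon>'))"
      using P(1) string_over_window unfolding approximates_lcs_def by meson
    \<comment> \<open>The time bound and the quality guarantee come from separate existential
      statements; determinism shows that they concern the same run.\<close>
    ultimately show ?thesis
      using exec_deterministic by blast
  qed
  obtain t \<sigma> where exec: "exec (phases s l P s) (input_state A B) t \<sigma>"
    and t: "real t \<le> 1 + real s * (27 * real n + 12 + T n)" and inv: "phase_inv s l A B ?c s \<sigma>"
    using runs_phases[OF AB sl(1) PT le_refl] unfolding runs_def by blast
  \<comment> \<open>Every run takes at least one step, so \<open>T n\<close> can absorb additive
    constants, even for \<open>n = 0\<close>: below, \<open>13\<close> is at most
    \<open>27 * T n\<close>.\<close>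
  have T: "1 \<le> T n"
    using PT[of 0] exec_time_pos by fastforce
  have "1 + real s * (27 * real n + 12 + T n) \<le> real s * (28 * (real n + T n))"
  proof -
    have "1 \<le> real s" using sl by simp
    then have "1 + real s * (27 * real n + 12 + T n) \<le> real s + real s * (27 * real n + 12 + T n)"
      by simp
    also have "\<dots> = real s * (27 * real n + 13 + T n)" by (simp add: algebra_simps)
    also have "\<dots> \<le> real s * (28 * (real n + T n))" using T by (intro mult_left_mono) auto
    finally show ?thesis .
  qed
  \<comment> \<open>\<open>s\<close> is at most \<open>s choose l\<close> because
    \<open>0 < l < s\<close>.\<close>
  also have "\<dots> \<le> real (s choose l) * (28 * (real n + T n))"
    using upper_le_binomial[of l s] sl T by (intro mult_right_mono) auto
  finally have time: "real t \<le> 28 * ((real n + T n) * real (s choose l))"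
    using t by (simp add: algebra_simps)
  obtain i where i: "i < s" "l * lcs A B \<le> s * lcs (window s l i A) (window s l i B)"
    using exists_good_window[OF AB(1) sl(1)] by blast
  have "real l * real (lcs A B) \<le> real s * real (lcs (window s l i A) (window s l i B))"
    using i(2) by (metis of_nat_le_iff of_nat_mult)
  then have le: "real l * real (lcs A B) / real s \<le> real (lcs (window s l i A) (window s l i B))"
    using sl by (simp add: field_simps)
  \<comment> \<open>The target ratio is the product of the window loss \<open>l / s\<close> and the
    ratio \<open>1 / (l - \<epsilon>)\<close> of the given program.\<close>
  have "1 / (real s * (1 - \<epsilon> / real l)) * real (lcs A B) = ?c * (real l * real (lcs A B) / real s)"
    using sl \<epsilon> by (simp add: field_simps)
  also have "\<dots> \<le> ?c * real (lcs (window s l i A) (window s l i B))"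
    using le \<epsilon> by (intro mult_left_mono) auto
  also have "\<dots> \<le> real (length (output_string \<sigma>))"
    using inv i(1) by (simp add: phase_inv_def)
  finally show ?thesis
    using exec inv time by (auto simp: phase_inv_def)
qed

theorem theorem4:
  "\<exists>C::real. C > 0 \<and>
     (\<forall>(s::nat) (l::nat) (\<epsilon>::real) (T :: nat \<Rightarrow> nat \<Rightarrow> real).
        s > l \<and> l \<ge> 2 \<and> 0 \<le> \<epsilon> \<and> \<epsilon> < real l \<and>
        (\<exists>P. approximates_lcs P l (1 / (real l - \<epsilon>)) \<and> runs_in_time P l (\<lambda>n. T n l))
        \<longrightarrow>
        (\<exists>Q. approximates_lcs Q s (1 / (real s * (1 - \<epsilon> / real l))) \<and>
             runs_in_time Q s (\<lambda>n. C * ((real n + T n l) * real (s choose l)))))"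
proof (intro exI[of _ 28] conjI allI impI)
  fix s l :: nat and \<epsilon> :: real and T :: "nat \<Rightarrow> nat \<Rightarrow> real"
  assume asm: "s > l \<and> l \<ge> 2 \<and> 0 \<le> \<epsilon> \<and> \<epsilon> < real l \<and>
    (\<exists>P. approximates_lcs P l (1 / (real l - \<epsilon>)) \<and> runs_in_time P l (\<lambda>n. T n l))"
  then obtain P where P: "approximates_lcs P l (1 / (real l - \<epsilon>))" "runs_in_time P l (\<lambda>n. T n l)"
    by blast
  have sl: "l < s" "2 \<le> l" "0 \<le> \<epsilon>" "\<epsilon> < real l"
    using asm by auto
  note lift = approximation_lift[OF sl P]
  show "\<exists>Q. approximates_lcs Q s (1 / (real s * (1 - \<epsilon> / real l))) \<and>
      runs_in_time Q s (\<lambda>n. 28 * ((real n + T n l) * real (s choose l)))"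
    unfolding approximates_lcs_def runs_in_time_def
  proof (intro exI[of _ "phases s l P s"] conjI allI impI)
    fix A B
    assume "string_over s A \<and> string_over s B"
    then show "\<exists>t \<sigma>. exec (phases s l P s) (input_state A B) t \<sigma> \<and> common_subseq (output_string \<sigma>) A B \<and>
        1 / (real s * (1 - \<epsilon> / real l)) * real (lcs A B) \<le> real (length (output_string \<sigma>))"
      \<comment> \<open>The approximation statement carries no length bound, so the tightest common
        one is supplied.\<close>
      using lift[of A B "max (length A) (length B)"] by auto
  next
    fix n A B
    assume "string_over s A \<and> string_over s B \<and> length A \<le> n \<and> length B \<le> n"
    then show "\<exists>t \<sigma>. exec (phases s l P s) (input_state A B) t \<sigma> \<and>
        real t \<le> 28 * ((real n + T n l) * real (s choose l))"
      using lift[of A B n] by auto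
  qed
qed simp

end
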